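(* Let $\mathbf{k}$ be a field, $n\in\mathbb{N}$, and $\lambda_1,\lambda_2,\ldots,\lambda_n\in\mathbf{k}$. Assume that the elements $\lambda_1m_{I,1}+\lambda_2m_{I,2}+\cdots+\lambda_nm_{I,n}$ of $\mathbf{k}$, for all lacunar subsets $I\subseteq[n-1]$, are distinct (i.e., different lacunar subsets $I$ give different elements). Then the endomorphism $R(\lambda_1t_1+\lambda_2t_2+\cdots+\lambda_nt_n)$ of $\mathbf{k}[S_n]$ is diagonalizable.
   Context: $\mathbb{N}=\{0,1,2,\ldots\}$; $[m]=\{1,\ldots,m\}$ (empty if $m\le 0$). $S_n$ is the group of permutations of $[n]$, with product $(\pi\sigma)(i)=\pi(\sigma(i))$; $\mathbf{k}[S_n]$ is its group algebra. For distinct $i_1,\ldots,i_k\in[n]$, $\operatorname{cyc}_{i_1,\ldots,i_k}\in S_n$ sends $i_1,\ldots,i_{k-1},i_k$ to $i_2,\ldots,i_k,i_1$, respectively, and fixes all other elements. For $\ell\in[n]$, $t_\ell:=\operatorname{cyc}_\ell+\operatorname{cyc}_{\ell,\ell+1}+\cdots+\operatorname{cyc}_{\ell,\ell+1,\ldots,n}\in\mathbf{k}[S_n]$. For $x\in\mathbf{k}[S_n]$, $R(x):\mathbf{k}[S_n]\to\mathbf{k}[S_n]$ is the $\mathbf{k}$-linear map $y\mapsto yx$. A set of integers is lacunar if it contains no two consecutive integers. For $I\subseteq[n]$ and $\ell\in[n]$, let $\widehat I:=\{0\}\cup I\cup\{n+1\}$ and $m_{I,\ell}:=(\text{smallest element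 of }\widehat I\text{ that is}\ge\ell)-\ell$ (an integer, viewed in $\mathbf{k}$ where appropriate). *)

theory Defs
  imports
    Complex_Main
    "HOL-Algebra.Sym_Groups"
    "HOL-Library.Function_Algebras"
begin

section \<open>Diagonalizable endomorphisms\<close>

text \<open>
  Here \<open>V\<close> is a subspace and \<open>f\<close> is linear with \<open>f ` V \<subseteq> V\<close>. The basis vectors are nonzero
  because they are independent, so they are eigenvectors of \<open>f\<close>.
\<close>

definition (in vector_space) diagonalizable_on :: "'b set \<Rightarrow> ('b \<Rightarrow> 'b) \<Rightarrow> bool" where
  "diagonalizable_on V f \<longleftrightarrow>
     (\<exists>B. independent B \<and> span B = V \<and> (\<forall>b\<in>B. \<exists>c. f b = c *s b))"


section \<open>The group algebra of the symmetric group\<close>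

text \<open>
  An element of the group algebra is its coefficient function, extended by \<open>0\<close> outside the group.
  Addition is the pointwise addition of \<^theory>\<open>HOL-Library.Function_Algebras\<close>. The
  pointwise \<open>*\<close> of that theory is not the product of the group algebra.
\<close>

type_synonym 'k perm_fun = "(nat \<Rightarrow> nat) \<Rightarrow> 'k"

definition ga_scale :: "'k::field \<Rightarrow> 'k perm_fun \<Rightarrow> 'k perm_fun" where
  "ga_scale c x = (\<lambda>g. c * x g)"

interpretation ga: vector_space ga_scale
  by unfold_locales (auto simp: ga_scale_def fun_eq_iff algebra_simps)

definition group_alg :: "nat \<Rightarrow> 'k::field perm_fun set" where
  "group_alg n = {x. \<forall>g. g \<notin> carrier (sym_group n) \<longrightarrow> x g = 0}"

definition ga_of :: "(nat \<Rightarrow> nat) \<Rightarrow> 'k::field perm_fun" where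
  "ga_of p = (\<lambda>g. if g = p then 1 else 0)"

definition ga_mult :: "nat \<Rightarrow> 'k::field perm_fun \<Rightarrow> 'k perm_fun \<Rightarrow> 'k perm_fun" where
  "ga_mult n x y = (\<lambda>g. \<Sum>(p, q) \<in> {(p, q). p \<in> carrier (sym_group n) \<and>
     q \<in> carrier (sym_group n) \<and> p \<otimes>\<^bsub>sym_group n\<^esub> q = g}. x p * y q)"

definition R :: "nat \<Rightarrow> 'k::field perm_fun \<Rightarrow> 'k perm_fun \<Rightarrow> 'k perm_fun" where
  "R n x = (\<lambda>y. ga_mult n y x)"

lemma subspace_group_alg: "ga.subspace (group_alg n)"
  by (auto simp: ga.subspace_def group_alg_def ga_scale_def)

lemma ga_mult_closed: "ga_mult n x y \<in> group_alg n"
proof -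
  interpret group "sym_group n" by (rule sym_group_is_group)
  show ?thesis
    by (auto simp: group_alg_def ga_mult_def intro!: sum.neutral)
qed

lemma linear_R: "Vector_Spaces.linear ga_scale ga_scale (R n x)"
  by unfold_locales
    (auto simp: R_def ga_mult_def ga_scale_def fun_eq_iff algebra_simps split_def
      sum.distrib sum_distrib_left)

lemma R_closed: "R n x ` group_alg n \<subseteq> group_alg n"
  by (auto simp: R_def ga_mult_closed)

lemma ga_of_mem: "p \<in> carrier (sym_group n) \<Longrightarrow> ga_of p \<in> group_alg n"
  by (auto simp: ga_of_def group_alg_def)

lemma ga_mult_ga_of:
  assumes "p \<in> carrier (sym_group n)" "q \<in> carrier (sym_group n)"
  shows "ga_mult n (ga_of p) (ga_of q) = ga_of (p \<circ> q)"
proof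
  fix g
  let ?S = "{(p, q). p \<in> carrier (sym_group n) \<and> q \<in> carrier (sym_group n) \<and>
              p \<otimes>\<^bsub>sym_group n\<^esub> q = g}"
  have "finite (carrier (sym_group n))"
    by (simp add: sym_group_def finite_permutations)
  then have "finite (carrier (sym_group n) \<times> carrier (sym_group n))"
    by simp
  then have fin: "finite ?S"
    by (rule rev_finite_subset) auto
  have "ga_mult n (ga_of p) (ga_of q) g
      = (\<Sum>z\<in>?S. if z = (p, q) then 1 else 0)"
    unfolding ga_mult_def ga_of_def by (rule sum.cong) (auto split: if_splits)
  also have "\<dots> = ga_of (p \<circ> q) g"
    using assms fin by (auto simp: ga_of_def sym_group_mult)
  finally show "ga_mult n (ga_of p) (ga_of q) g = ga_of (p \<circ> q) g" .
qed


section \<open>Somewhere-to-below shuffles\<close>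

text \<open>\<open>[l..<Suc m]\<close> is the list \<open>l, l + 1, \<dots>, m\<close>.\<close>

definition t :: "nat \<Rightarrow> nat \<Rightarrow> 'k::field perm_fun" where
  "t n l = (\<Sum>m = l..n. ga_of (cycle_of_list [l..<Suc m]))"

lemma cycle_of_list_nth:
  assumes "distinct cs" "i < length cs"
  shows "cycle_of_list cs (cs ! i) = cs ! (Suc i mod length cs)"
proof -
  have "map (cycle_of_list cs) cs = rotate 1 cs"
    using cyclic_rotation[OF assms(1), of 1] by simp
  then have "map (cycle_of_list cs) cs ! i = rotate 1 cs ! i" by simp
  then show ?thesis using assms(2) by (simp add: nth_rotate del: rotate_Suc)
qed

lemma t_mem: "l \<in> {1..n} \<Longrightarrow> t n l \<in> group_alg n"
  unfolding t_def
  by (intro ga.subspace_sum[OF subspace_group_alg] ga_of_mem)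
    (auto simp: sym_group_carrier intro!: permutes_subset[OF cycle_permutes])


section \<open>Lacunar sets\<close>

definition lacunar :: "nat set \<Rightarrow> bool" where
  "lacunar I \<longleftrightarrow> (\<forall>i\<in>I. Suc i \<notin> I)"

definition enclosure :: "nat \<Rightarrow> nat set \<Rightarrow> nat set" where
  "enclosure n I = {0} \<union> I \<union> {n + 1}"

definition m_stat :: "nat \<Rightarrow> nat set \<Rightarrow> nat \<Rightarrow> int" where
  "m_stat n I l = int (Min {j \<in> enclosure n I. l \<le> j}) - int l"

end

theory Submission
  imports Defs
begin

text \<open>
  Write \<open>s\<^sub>j\<close> for the transposition of \<open>j\<close> and \<open>j + 1\<close>, and for a set \<open>I\<close> of numbers let
  \<open>fixed n I\<close> be the space of all \<open>q\<close> in the group algebra with \<open>q s\<^sub>j = q\<close> whenever neither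
  \<open>j\<close> nor \<open>j + 1\<close> lies in \<open>I\<close>. These spaces, for lacunar \<open>I\<close> ordered by a weight \<open>wt I\<close>
  that is essentially the sum of the elements of \<open>I\<close>, triangularize all the shuffles \<open>t n l\<close>
  at once: on \<open>fixed n I\<close> the shuffle \<open>t n l\<close> acts as the scalar \<open>m_stat n I l\<close> up to an
  error in the sum of the spaces \<open>fixed n J\<close> of smaller weight (\<open>R_t_triangular\<close>).

  To see this, let \<open>i\<close> be the least element of \<open>I \<union> {n + 1}\<close> with \<open>i \<ge> l\<close>, and recall
  \<open>cyc l w = s\<^sub>l s\<^bsub>l+1\<^esub> \<dots> s\<^bsub>w-1\<^esub>\<close>. For \<open>w < i\<close> every factor fixes \<open>q\<close>, which yields
  \<open>i - l\<close> copies of \<open>q\<close>. The remaining terms \<open>w = i, \<dots>, n\<close> are cut into blocks at the elements of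
  \<open>I\<close>. The sum over one block, \<open>w = k, \<dots>, k' - 1\<close> for neighbours \<open>k < k'\<close>, lies in
  \<open>fixed n J\<close>, where \<open>J\<close> arises from \<open>I\<close> by decreasing each of its elements between
  \<open>l\<close> and \<open>k\<close> by one (\<open>ract_block_fixed\<close>); this \<open>J\<close> has smaller weight. It need not be lacunar,
  but a non-lacunar index can always be replaced by a lacunar one of at most the same weight whose
  space is at least as large (\<open>fixed_subset_lacunar\<close>). The same replacement, starting from
  \<open>{1, \<dots>, n}\<close>, shows that the lacunar spaces span the whole group algebra.

  A linear combination of the \<open>t n l\<close> is therefore triangular as well, with one diagonal entry for
  each lacunar set. Since these entries are assumed distinct, each vector of a lacunar space can be
  corrected by lower terms to an eigenvector (\<open>diagonalizable_on_if_triangular\<close>).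
\<close>


section \<open>Triangular actions with distinct diagonal entries\<close>

text \<open>
  By induction on the weight, \<open>F i\<close> lies in the span of the eigenvectors with eigenvalues
  \<open>ev j\<close>, \<open>wt j \<le> wt i\<close>. For \<open>v\<close> in \<open>F i\<close>, the error \<open>u = T v - ev i *s v\<close> is a sum of
  eigenvectors whose eigenvalues differ from \<open>ev i\<close>, so \<open>T w - ev i *s w = u\<close> has a solution
  \<open>w\<close> among such sums, and then \<open>v - w\<close> is zero or an eigenvector for \<open>ev i\<close>.
\<close>

lemma (in vector_space) diagonalizable_on_if_triangular:
  fixes wt :: "'i \<Rightarrow> nat" and F :: "'i \<Rightarrow> 'b set" and ev :: "'i \<Rightarrow> 'a"
  assumes lin: "Vector_Spaces.linear scale scale T"
    and V: "span (\<Union>i\<in>A. F i) = V"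
    and inj: "inj_on ev A"
    and tri: "\<And>i v. i \<in> A \<Longrightarrow> v \<in> F i \<Longrightarrow>
      T v - ev i *s v \<in> span (\<Union>j\<in>{j \<in> A. wt j < wt i}. F j)"
  shows "diagonalizable_on V T"
proof -
  interpret T: Vector_Spaces.linear scale scale T by (rule lin)
  define E where "E k = {x \<in> V. \<exists>j\<in>A. wt j < k \<and> T x = ev j *s x}" for k
  have FV: "F i \<subseteq> V" if "i \<in> A" for i
    using that span_superset V by blast
  have subV: "subspace V" using V subspace_span by blast
  have E_mono: "E k \<subseteq> E k'" if "k \<le> k'" for k k'
    using that unfolding E_def by (blast intro: less_le_trans)
  have solve: "\<exists>w\<in>span (E (wt i)). T w - ev i *s w = u"
    if i: "i \<in> A" and u: "u \<in> span (E (wt i))" for i u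
    using u
  proof (induction rule: span_induct_alt)
    case base
    show ?case by (intro bexI[of _ 0]) (auto simp: T.zero span_zero)
  next
    case (step c x y)
    then obtain j where j: "j \<in> A" "wt j < wt i" "T x = ev j *s x"
      by (auto simp: E_def)
    from step obtain w where w: "w \<in> span (E (wt i))" "T w - ev i *s w = y"
      by blast
    have ne: "ev j - ev i \<noteq> 0"
      using inj j i by (auto dest: inj_onD)
    \<comment> \<open>On \<open>x\<close> the map \<open>T - ev i\<close> acts as the scalar \<open>ev j - ev i\<close>.\<close>
    let ?d = "c / (ev j - ev i)"
    have "T (?d *s x + w) - ev i *s (?d *s x + w)
        = (?d * ev j - ev i * ?d) *s x + (T w - ev i *s w)"
      by (simp add: T.add T.scale j(3) scale_right_distrib scale_left_diff_distrib)
    also have "?d * ev j - ev i * ?d = ?d * (ev j - ev i)"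
      by (simp only: right_diff_distrib mult.commute[of ?d])
    also have "\<dots> *s x + (T w - ev i *s w) = c *s x + y" using ne w by simp
    finally have "T (?d *s x + w) - ev i *s (?d *s x + w) = c *s x + y" .
    then show ?case
      using w step.hyps by (intro bexI[of _ "?d *s x + w"]) (auto intro: span_add span_scale span_base)
  qed
  have main: "F i \<subseteq> span (E (Suc (wt i)))" if "i \<in> A" for i
    using that
  proof (induction "wt i" arbitrary: i rule: less_induct)
    case less
    show ?case
    proof
      fix v assume v: "v \<in> F i"
      have "(\<Union>j\<in>{j \<in> A. wt j < wt i}. F j) \<subseteq> span (E (wt i))"
      proof (rule UN_least)
        fix j assume j: "j \<in> {j \<in> A. wt j < wt i}"
        then have "F j \<subseteq> span (E (Suc (wt j)))" using less by auto
        also have "\<dots> \<subseteq> span (E (wt i))" using j by (intro span_mono E_mono) auto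
        finally show "F j \<subseteq> span (E (wt i))" .
      qed
      then have "T v - ev i *s v \<in> span (E (wt i))"
        using tri[OF less.prems v] span_minimal[OF _ subspace_span] by blast
      then obtain w where w: "w \<in> span (E (wt i))" "T w - ev i *s w = T v - ev i *s v"
        using solve[OF less.prems] by blast
      have wV: "w \<in> V"
        using w(1) span_minimal[OF _ subV, of "E (wt i)"] by (auto simp: E_def)
      have "v - w \<in> V" using v FV less.prems wV by (auto intro: subspace_diff[OF subV])
      moreover have "T (v - w) = ev i *s (v - w)"
        using w(2) by (simp add: T.diff scale_right_diff_distrib algebra_simps)
      ultimately have "v - w \<in> E (Suc (wt i))" using less.prems by (auto simp: E_def)
      moreover have "w \<in> span (E (Suc (wt i)))"
        using w(1) span_mono[OF E_mono, of "wt i" "Suc (wt i)"] by auto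
      ultimately have "(v - w) + w \<in> span (E (Suc (wt i)))"
        by (rule span_add[OF span_base])
      then show "v \<in> span (E (Suc (wt i)))" by simp
    qed
  qed
  let ?E = "{x \<in> V. \<exists>c. T x = c *s x}"
  have "span (E k) \<subseteq> span ?E" for k
    by (rule span_mono) (auto simp: E_def)
  then have "(\<Union>i\<in>A. F i) \<subseteq> span ?E" using main by blast
  then have VE: "V \<subseteq> span ?E" using V span_minimal[OF _ subspace_span] by blast
  obtain B where B: "B \<subseteq> ?E" "independent B" "?E \<subseteq> span B"
    using maximal_independent_subset by blast
  have "V \<subseteq> span B" using VE span_minimal[OF B(3) subspace_span] by blast
  moreover have "span B \<subseteq> V" using B(1) by (intro span_minimal subV) auto
  ultimately show ?thesis
    unfolding diagonalizable_on_def using B by blast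
qed


section \<open>Right multiplication by permutations and cycles\<close>

text \<open>
  Right multiplication by a single permutation \<open>p\<close>: the coefficient of \<open>g\<close> in \<open>y p\<close> is that of
  \<open>g p\<^sup>-\<^sup>1\<close> in \<open>y\<close>. Unlike \<open>ga_mult\<close> this does not refer to \<open>n\<close>, and associativity is immediate.
\<close>

definition ract :: "'k::field perm_fun \<Rightarrow> (nat \<Rightarrow> nat) \<Rightarrow> 'k perm_fun" where
  "ract y p = (\<lambda>g. y (g \<circ> inv_into UNIV p))"

lemma ga_mult_ga_of_right:
  assumes y: "y \<in> group_alg n" and p: "p permutes {1..n}"
  shows "ga_mult n y (ga_of p) = ract y p"
proof
  fix g
  let ?S = "{(a, b). a \<in> carrier (sym_group n) \<and> b \<in> carrier (sym_group n) \<and>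
              a \<otimes>\<^bsub>sym_group n\<^esub> b = g}"
  have "finite (carrier (sym_group n))"
    by (simp add: sym_group_def finite_permutations)
  then have "finite (carrier (sym_group n) \<times> carrier (sym_group n))"
    by simp
  then have fin: "finite ?S"
    by (rule rev_finite_subset) auto
  have eq: "g \<circ> inv_into UNIV p \<circ> p = g" "\<And>a. a \<circ> p \<circ> inv_into UNIV p = a"
    using permutes_inv_o[OF p] by (simp_all add: comp_assoc)
  have "ga_mult n y (ga_of p) g
      = (\<Sum>z\<in>?S. if z = (g \<circ> inv_into UNIV p, p) then y (g \<circ> inv_into UNIV p) else 0)"
    unfolding ga_mult_def ga_of_def
    by (rule sum.cong) (auto simp: sym_group_mult eq split: if_splits)
  also have "\<dots> = (if (g \<circ> inv_into UNIV p, p) \<in> ?S then y (g \<circ> inv_into UNIV p) else 0)"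
    using fin by simp
  also have "\<dots> = y (g \<circ> inv_into UNIV p)"
    using y p by (auto simp: group_alg_def sym_group_mult sym_group_carrier eq)
  finally show "ga_mult n y (ga_of p) g = ract y p g" by (simp add: ract_def)
qed

lemma ract_closed:
  assumes "y \<in> group_alg n" "p permutes {1..n}"
  shows "ract y p \<in> group_alg n"
  using ga_mult_ga_of_right[OF assms] ga_mult_closed[of n y "ga_of p"] by metis

lemma ract_id [simp]: "ract y id = y" "ract y (\<lambda>x. x) = y"
  by (simp_all add: ract_def comp_def inv_id[unfolded id_def])

lemma ract_comp: "bij p \<Longrightarrow> bij q \<Longrightarrow> ract y (p \<circ> q) = ract (ract y p) q"
  by (simp add: ract_def o_inv_distrib comp_assoc)

lemma ract_add: "ract (x + y) p = ract x p + ract y p"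
  by (simp add: ract_def fun_eq_iff)

lemma ract_sum: "ract (sum h A) p = (\<Sum>w\<in>A. ract (h w) p)"
proof (induction A rule: infinite_finite_induct)
  case (insert a A)
  show ?case
    unfolding sum.insert[OF insert.hyps] ract_add insert.IH by (rule refl)
qed (auto simp: ract_def)

lemma ga_mult_sum_right: "ga_mult n y (sum h A) = (\<Sum>w\<in>A. ga_mult n y (h w))"
proof -
  have "ga_mult n y (u + v) = ga_mult n y u + ga_mult n y v" for u v
    by (simp add: ga_mult_def fun_eq_iff split_def algebra_simps sum.distrib)
  moreover have "ga_mult n y 0 = 0"
    by (simp add: ga_mult_def fun_eq_iff split_def)
  ultimately show ?thesis
    by (induction A rule: infinite_finite_induct) simp_all
qed

lemma ga_mult_scale_right: "ga_mult n y (ga_scale c x) = ga_scale c (ga_mult n y x)"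
  by (simp add: ga_mult_def ga_scale_def fun_eq_iff split_def sum_distrib_left algebra_simps)

definition cyc :: "nat \<Rightarrow> nat \<Rightarrow> nat \<Rightarrow> nat" where
  "cyc a w = cycle_of_list [a..<Suc w]"

definition adj :: "nat \<Rightarrow> nat \<Rightarrow> nat" where
  "adj j = transpose j (Suc j)"

text \<open>
  The product relations between \<open>cyc\<close> and \<open>adj\<close> below are all verified pointwise
  from this description, which avoids reduced words.
\<close>

lemma cyc_apply:
  assumes "a \<le> w"
  shows "cyc a w x = (if x < a \<or> w < x then x else if x = w then a else Suc x)"
proof (cases "x < a \<or> w < x")
  case True
  then show ?thesis
    using id_outside_supp[of x "[a..<Suc w]"] by (auto simp: cyc_def)
next
  case False
  then have x: "[a..<Suc w] ! (x - a) = x" "x - a < length [a..<Suc w]"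
    by (auto simp del: upt_Suc)
  have "cyc a w x = [a..<Suc w] ! (Suc (x - a) mod length [a..<Suc w])"
    using cycle_of_list_nth[of "[a..<Suc w]" "x - a"] x unfolding cyc_def by simp
  also have "\<dots> = (if x = w then a else Suc x)"
    using False assms by (auto simp del: upt_Suc simp: Suc_diff_le)
  finally show ?thesis using False by simp
qed

lemma cyc_permutes: "1 \<le> a \<Longrightarrow> w \<le> n \<Longrightarrow> cyc a w permutes {1..n}"
  unfolding cyc_def by (rule permutes_subset[OF cycle_permutes]) auto

lemma bij_cyc: "bij (cyc a w)"
  unfolding cyc_def by (rule permutes_bij[OF cycle_permutes])

lemma bij_adj: "bij (adj j)"
  by (simp add: adj_def)

lemma cyc_refl [simp]: "cyc a a = id"
  by (auto simp: fun_eq_iff cyc_apply)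

lemma cyc_trans: "a \<le> b \<Longrightarrow> b \<le> w \<Longrightarrow> cyc a w = cyc a b \<circ> cyc b w"
  by (auto simp: fun_eq_iff cyc_apply)

lemma cyc_Suc: "a \<le> w \<Longrightarrow> cyc a (Suc w) = cyc a w \<circ> adj w"
  by (auto simp: fun_eq_iff cyc_apply adj_def transpose_def)

lemma cyc_adj_below: "a \<le> w \<Longrightarrow> Suc j < a \<Longrightarrow> cyc a w \<circ> adj j = adj j \<circ> cyc a w"
  by (auto simp: fun_eq_iff cyc_apply adj_def transpose_def)

lemma cyc_adj_above: "a \<le> w \<Longrightarrow> w < j \<Longrightarrow> cyc a w \<circ> adj j = adj j \<circ> cyc a w"
  by (auto simp: fun_eq_iff cyc_apply adj_def transpose_def)

text \<open>
  Moving \<open>s\<^sub>j\<close> to the left through a cycle that contains \<open>j\<close>, \<open>j + 1\<close> and \<open>j + 2\<close> shifts its index.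
  This shift is the reason why the elements of the index set move down by one in a block.
\<close>

lemma cyc_adj_inside:
  "a \<le> j \<Longrightarrow> Suc j < w \<Longrightarrow> cyc a w \<circ> adj j = adj (Suc j) \<circ> cyc a w"
  by (auto simp: fun_eq_iff cyc_apply adj_def transpose_def)

lemma cyc_adj_top: "a \<le> j \<Longrightarrow> cyc a (Suc j) \<circ> adj j = cyc a j"
  by (auto simp: fun_eq_iff cyc_apply adj_def transpose_def)


section \<open>Subspaces of elements fixed by adjacent transpositions\<close>

definition fixed :: "nat \<Rightarrow> nat set \<Rightarrow> 'k::field perm_fun set" where
  "fixed n I = {q \<in> group_alg n.
     \<forall>j. 1 \<le> j \<and> j < n \<and> j \<notin> I \<and> Suc j \<notin> I \<longrightarrow> ract q (adj j) = q}"

text \<open>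
  Each element \<open>x\<close> counts \<open>x + 1\<close> rather than \<open>x\<close>, so that dropping a \<open>0\<close>, which may appear when
  elements are decreased, also lowers the weight.
\<close>

definition wt :: "nat set \<Rightarrow> nat" where
  "wt I = (\<Sum>x\<in>I. Suc x)"

lemma wt_image_less:
  assumes "finite I" "k \<in> I" "f k < k" "\<And>x. x \<in> I \<Longrightarrow> f x \<le> x"
  shows "wt (f ` I) < wt I"
proof -
  have "wt (f ` I) \<le> (\<Sum>x\<in>I. Suc (f x))"
    unfolding wt_def using sum_image_le[OF assms(1), of Suc f] by simp
  also have "\<dots> < wt I"
    unfolding wt_def by (rule sum_strict_mono_ex1) (use assms in auto)
  finally show ?thesis .
qed

lemma wt_remove_less: "finite I \<Longrightarrow> x \<in> I \<Longrightarrow> wt (I - {x}) < wt I"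
  unfolding wt_def by (simp add: sum.remove)

abbreviation (input) lac :: "nat \<Rightarrow> nat set set" where
  "lac n \<equiv> {I. I \<subseteq> {1..n - 1} \<and> lacunar I}"

text \<open>
  The space \<open>fixed n I\<close> grows with the set of those \<open>j\<close> in \<open>{1..<n}\<close> that \<open>I\<close> exempts from the
  condition \<open>q s\<^sub>j = q\<close>; these are the elements of \<open>I\<close> and their predecessors. An element \<open>0\<close>
  or greater than \<open>n\<close> exempts nothing in this range and can be dropped. An element \<open>n\<close>
  exempts at most \<open>n - 1\<close>, and \<open>n - 1\<close> does so too. Two consecutive elements \<open>x, x + 1\<close> exempt
  \<open>x - 1, x, x + 1\<close>, and the elements \<open>x - 1, x + 1\<close> exempt these as well. All these changes lower
  the weight, and an \<open>I\<close> that admits none of them is lacunar in \<open>{1..n - 1}\<close>.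
\<close>

lemma fixed_subset_lacunar:
  assumes "finite I"
  shows "\<exists>L\<in>lac n. wt L \<le> wt I \<and> (fixed n I :: 'k::field perm_fun set) \<subseteq> fixed n L"
  using assms
proof (induction "wt I" arbitrary: I rule: less_induct)
  case less
  have step: ?case
    if J: "finite J" "wt J < wt I" "(fixed n I :: 'k perm_fun set) \<subseteq> fixed n J" for J
  proof -
    obtain L where "L \<in> lac n" "wt L \<le> wt J" "(fixed n J :: 'k perm_fun set) \<subseteq> fixed n L"
      using less.hyps[OF J(2,1)] by (elim bexE conjE)
    with J show ?thesis by (intro bexI[of _ L] conjI) auto
  qed
  have "I \<in> lac n"
    if h: "\<forall>x\<in>I. x \<noteq> 0 \<and> \<not> n < x" "n \<notin> I" "\<forall>x\<in>I. Suc x \<notin> I"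
  proof -
    have "x \<in> {1..n - 1}" if "x \<in> I" for x
    proof -
      have "x \<noteq> 0" "\<not> n < x" "x \<noteq> n" using that h by auto
      then show ?thesis by auto
    qed
    then show ?thesis using h by (auto simp: lacunar_def)
  qed
  then have "(\<exists>x. x \<in> I \<and> (x = 0 \<or> n < x)) \<or> (n \<in> I \<and> 0 < n)
    \<or> (\<exists>x. x \<in> I \<and> Suc x \<in> I \<and> 0 < x) \<or> I \<in> lac n"
    by (metis gr0I)
  then consider x where "x \<in> I" "x = 0 \<or> n < x" | "n \<in> I" "0 < n"
    | x where "x \<in> I" "Suc x \<in> I" "0 < x" | "I \<in> lac n"
    by (elim disjE exE conjE) simp_all
  then show ?case
  proof cases
    case 1
    have "fixed n I \<subseteq> (fixed n (I - {x}) :: 'k perm_fun set)"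
      using 1 by (auto simp: fixed_def)
    with 1 less.prems show ?thesis by (intro step[of "I - {x}"] wt_remove_less) auto
  next
    case 2
    let ?f = "\<lambda>x. if x = n then n - 1 else x"
    have "fixed n I \<subseteq> (fixed n (?f ` I) :: 'k perm_fun set)"
    proof -
      have "j \<notin> I \<and> Suc j \<notin> I" if "j < n" "j \<notin> ?f ` I" "Suc j \<notin> ?f ` I" for j
      proof -
        have "Suc j \<noteq> n" using that 2 by (force simp: image_iff)
        then show ?thesis using that by (force simp: image_iff)
      qed
      then show ?thesis by (auto simp: fixed_def)
    qed
    moreover have "wt (?f ` I) < wt I"
      using 2 less.prems by (intro wt_image_less[of I n]) auto
    ultimately show ?thesis using less.prems by (intro step) auto
  next
    case 3
    let ?f = "\<lambda>y. if y = x then x - 1 else y"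
    have "fixed n I \<subseteq> (fixed n (?f ` I) :: 'k perm_fun set)"
    proof -
      have "j \<notin> I \<and> Suc j \<notin> I" if "j \<notin> ?f ` I" "Suc j \<notin> ?f ` I" for j
      proof -
        have "x - 1 \<in> ?f ` I" "Suc x \<in> ?f ` I" using 3 by (force simp: image_iff)+
        then have "j \<noteq> x" "Suc j \<noteq> x" using that by auto
        then show ?thesis using that by (force simp: image_iff)
      qed
      then show ?thesis by (auto simp: fixed_def)
    qed
    moreover have "wt (?f ` I) < wt I"
      using 3 less.prems by (intro wt_image_less[of I x]) auto
    ultimately show ?thesis using less.prems by (intro step) auto
  next
    case 4
    then show ?thesis by blast
  qed
qed


section \<open>The shuffles act triangularly\<close>

text \<open>
  The key computation. Let \<open>s\<^sub>j\<close> be one of the transpositions that the shifted index set allows.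
  Then \<open>(q cyc a w) s\<^sub>j = q cyc a (s\<^sub>j w)\<close> for every \<open>w\<close> in the block, so \<open>s\<^sub>j\<close> merely permutes the
  summands; it maps the block to itself because \<open>j\<close> is neither \<open>k - 1\<close> nor \<open>k' - 1\<close>.
  The equation is a product relation for \<open>w = j\<close> and \<open>w = j + 1\<close>. In the other cases \<open>s\<^sub>j\<close> moves
  through the cycle and becomes \<open>s\<^sub>j\<close> or \<open>s\<^bsub>j+1\<^esub>\<close>, and the shifted index set is just large enough
  to ensure that this transposition fixes \<open>q\<close>. The hypothesis that \<open>a\<close> or \<open>a + 1\<close> is in \<open>I\<close>
  excludes \<open>j = a - 1\<close>, for which \<open>s\<^sub>j\<close> neither commutes with the cycles nor shifts.
\<close>

lemma ract_block_fixed: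
  assumes q: "q \<in> fixed n I"
    and le: "1 \<le> a" "a \<le> k" "k < k'" "k' \<le> Suc n"
    and k: "k \<in> I" and near: "a \<in> I \<or> Suc a \<in> I"
    and k': "k' \<in> I \<or> k' = Suc n"
    and gap: "\<And>x. k < x \<Longrightarrow> x < k' \<Longrightarrow> x \<notin> I"
  shows "(\<Sum>w = k..<k'. ract q (cyc a w))
    \<in> fixed n ((\<lambda>x. if a \<le> x \<and> x \<le> k then x - 1 else x) ` I)" (is "?X \<in> fixed n (?f ` I)")
  unfolding fixed_def
proof (intro CollectI conjI allI impI)
  have qga: "q \<in> group_alg n" using q by (simp add: fixed_def)
  show "?X \<in> group_alg n"
    using qga le by (intro ga.subspace_sum[OF subspace_group_alg] ract_closed cyc_permutes) auto
  fix j assume j: "1 \<le> j \<and> j < n \<and> j \<notin> ?f ` I \<and> Suc j \<notin> ?f ` I"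
  have notI: "?f x \<noteq> j \<and> ?f x \<noteq> Suc j" if "x \<in> I" for x
    using imageI[OF that, of ?f] j by (metis (no_types, lifting))
  have fix_q: "ract q (adj i) = q" if "1 \<le> i" "i < n" "i \<notin> I" "Suc i \<notin> I" for i
    using q that by (simp add: fixed_def)
  have inv_if: "ract (ract q (cyc a w)) (adj j) = ract q (cyc a w)"
    if "cyc a w \<circ> adj j = adj i \<circ> cyc a w" "1 \<le> i" "i < n" "i \<notin> I" "Suc i \<notin> I" for w i
    using that fix_q[of i] ract_comp[of _ _ q] bij_cyc bij_adj by metis
  have j_ne: "j \<noteq> k - 1" "Suc j \<noteq> k'"
    using notI[OF k] notI[of k'] k' le j by (auto split: if_splits)
  have j_ne2: "Suc j \<noteq> a"
    using near notI[of a] notI[of "Suc a"] notI[OF k] le by (auto split: if_splits)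
  \<comment> \<open>The block contains both or neither of \<open>j\<close> and \<open>j + 1\<close>.\<close>
  have far: "j \<in> {k..<k'} \<longleftrightarrow> Suc j \<in> {k..<k'}"
    using j_ne le by auto
  have "ract ?X (adj j) = (\<Sum>w = k..<k'. ract (ract q (cyc a w)) (adj j))"
    by (rule ract_sum)
  also have "\<dots> = (\<Sum>w = k..<k'. ract q (cyc a (adj j w)))"
  proof (rule sum.cong)
    fix w assume w: "w \<in> {k..<k'}"
    consider "Suc j < a" | "a \<le> j" "w < j" | "a \<le> j" "w = j" | "a \<le> j" "w = Suc j"
      | "a \<le> j" "Suc j < w"
      using j_ne2 by linarith
    then show "ract (ract q (cyc a w)) (adj j) = ract q (cyc a (adj j w))"
    proof cases
      case 1
      then have "j \<notin> I" "Suc j \<notin> I" using notI[of j] notI[of "Suc j"] by auto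
      with 1 j w le show ?thesis
        using inv_if[OF cyc_adj_below, of w] by (simp add: adj_def transpose_def)
    next
      case 2
      then have "j \<notin> I" "Suc j \<notin> I" using notI[of j] notI[of "Suc j"] w by auto
      with 2 j w le show ?thesis
        using inv_if[OF cyc_adj_above, of w] by (simp add: adj_def transpose_def)
    next
      case 3
      then show ?thesis
        using cyc_Suc[of a j] ract_comp[OF bij_cyc bij_adj, of q a j j] by (simp add: adj_def)
    next
      case 4
      then show ?thesis
        using cyc_adj_top[of a j] ract_comp[OF bij_cyc bij_adj, of q a "Suc j" j]
        by (simp add: adj_def)
    next
      case 5
      have "Suc j \<notin> I" "Suc (Suc j) \<notin> I"
        using notI[of "Suc j"] notI[of "Suc (Suc j)"] gap[of "Suc j"] gap[of "Suc (Suc j)"] 5 w k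
        by (auto split: if_splits)
      with 5 w le show ?thesis
        using inv_if[OF cyc_adj_inside, of w] by (simp add: adj_def transpose_def)
    qed
  qed simp
  also have "\<dots> = ?X"
  proof (rule sum.reindex_bij_betw)
    show "bij_betw (adj j) {k..<k'} {k..<k'}"
    proof (cases "j \<in> {k..<k'}")
      case True
      then show ?thesis
        using far unfolding adj_def by (intro permutes_imp_bij permutes_swap_id) auto
    next
      case False
      then have "adj j w = w" if "w \<in> {k..<k'}" for w
        using that far by (auto simp: adj_def transpose_def)
      then show ?thesis using bij_betw_cong[of "{k..<k'}" "adj j" id] by simp
    qed
  qed
  finally show "ract ?X (adj j) = ?X" .
qed

text \<open>
  The filtration of the group algebra in which the shuffles are triangular. By
  \<open>fixed_subset_lacunar\<close>, admitting non-lacunar index sets would not enlarge these spaces.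
\<close>

definition lower :: "nat \<Rightarrow> nat \<Rightarrow> 'k::field perm_fun set" where
  "lower n k = ga.span (\<Union>L\<in>{L \<in> lac n. wt L < k}. fixed n L)"

lemma fixed_subset_lower:
  assumes "finite I" "wt I < k"
  shows "fixed n I \<subseteq> lower n k"
proof -
  obtain L where L: "L \<in> lac n" "wt L \<le> wt I" "fixed n I \<subseteq> (fixed n L :: 'a perm_fun set)"
    using fixed_subset_lacunar[OF assms(1), of n] by blast
  then have mem: "L \<in> {L \<in> lac n. wt L < k}" using assms(2) by simp
  note L(3)
  also have "fixed n L \<subseteq> (\<Union>L\<in>{L \<in> lac n. wt L < k}. fixed n L :: 'a perm_fun set)"
    using mem by (rule UN_upper)
  also have "\<dots> \<subseteq> lower n k" unfolding lower_def by (rule ga.span_superset)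
  finally show ?thesis .
qed

lemma sum_atLeastAtMost_split:
  fixes h :: "nat \<Rightarrow> 'a::comm_monoid_add"
  assumes "a \<le> b" "b \<le> Suc n"
  shows "sum h {a..n} = sum h {a..<b} + sum h {b..n}"
  using sum.atLeastLessThan_concat[OF assms, of h]
  by (simp add: atLeastLessThanSuc_atLeastAtMost)

lemma ract_tail_lower:
  assumes q: "q \<in> fixed n I" and I: "I \<subseteq> {1..n}"
    and a: "1 \<le> a" "a \<le> k" "a \<in> I \<or> Suc a \<in> I"
    and k: "k \<in> I \<or> k = Suc n"
  shows "(\<Sum>w = k..n. ract q (cyc a w)) \<in> lower n (wt I)"
  using a(2) k
proof (induction "Suc n - k" arbitrary: k rule: less_induct)
  case less
  have fin: "finite I" using I finite_subset by blast
  show ?case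
  proof (cases "k = Suc n")
    case True
    then show ?thesis by (simp add: lower_def ga.span_zero)
  next
    case False
    then have kI: "k \<in> I" "k \<le> n" using less.prems I by auto
    define k' where "k' = (LEAST x. k < x \<and> (x \<in> I \<or> x = Suc n))"
    have ex: "k < Suc n \<and> (Suc n \<in> I \<or> Suc n = Suc n)" using kI by simp
    have k': "k < k'" "k' \<in> I \<or> k' = Suc n"
      using LeastI[of "\<lambda>x. k < x \<and> (x \<in> I \<or> x = Suc n)" "Suc n", OF ex] by (simp_all add: k'_def)
    have k'n: "k' \<le> Suc n" unfolding k'_def by (rule Least_le) (use ex in simp)
    have gap: "x \<notin> I" if "k < x" "x < k'" for x
      using not_less_Least[of x "\<lambda>x. k < x \<and> (x \<in> I \<or> x = Suc n)"] that
      by (auto simp: k'_def)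
    let ?f = "\<lambda>x. if a \<le> x \<and> x \<le> k then x - 1 else x"
    have "(\<Sum>w = k..<k'. ract q (cyc a w)) \<in> fixed n (?f ` I)"
      using q a(1) less.prems(1) k'(1) k'n kI(1) a(3) k'(2) gap by (rule ract_block_fixed)
    moreover have "wt (?f ` I) < wt I"
      using fin kI(1) by (rule wt_image_less) (use a less.prems in auto)
    ultimately have "(\<Sum>w = k..<k'. ract q (cyc a w)) \<in> lower n (wt I)"
      using fixed_subset_lower[of "?f ` I"] fin by blast
    moreover have "(\<Sum>w = k'..n. ract q (cyc a w)) \<in> lower n (wt I)"
      using less.hyps[of k'] k' k'n kI less.prems by auto
    moreover have "(\<Sum>w = k..n. ract q (cyc a w))
        = (\<Sum>w = k..<k'. ract q (cyc a w)) + (\<Sum>w = k'..n. ract q (cyc a w))"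
      using k'(1) k'n by (intro sum_atLeastAtMost_split) auto
    ultimately show ?thesis by (simp add: lower_def ga.span_add)
  qed
qed

text \<open>
  The terms with \<open>w < i\<close> give the eigenvalue and the others are errors. The block
  computation cannot be applied to the latter with \<open>a = l\<close>, since \<open>l\<close> may be far below \<open>i\<close>; but
  \<open>q\<close> absorbs the part \<open>cyc l a\<close> of each cycle for \<open>a = max l (i - 1)\<close>, which is
  adjacent to \<open>i\<close>.
\<close>

lemma R_t_triangular:
  assumes q: "q \<in> fixed n I" and I: "I \<subseteq> {1..n}" and l: "l \<in> {1..n}"
  shows "R n (t n l) q - ga_scale (of_int (m_stat n I l)) q \<in> lower n (wt I)"
proof -
  have qga: "q \<in> group_alg n" using q by (simp add: fixed_def)
  have fin: "finite I" using I finite_subset by blast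
  define S where "S = {j \<in> enclosure n I. l \<le> j}"
  define i where "i = Min S"
  have finS: "finite S" using fin by (simp add: S_def enclosure_def)
  have nS: "Suc n \<in> S" using l by (simp add: S_def enclosure_def)
  have iS: "i \<in> S" unfolding i_def using finS nS by (intro Min_in) auto
  have i_le: "i \<le> x" if "x \<in> S" for x unfolding i_def using finS that by simp
  have i: "l \<le> i" "i \<in> I \<or> i = Suc n" "i \<le> Suc n"
    using iS i_le[OF nS] l by (auto simp: S_def enclosure_def)
  have gap: "x \<notin> I" if "l \<le> x" "x < i" for x
    using i_le[of x] that by (auto simp: S_def enclosure_def)
  have head: "ract q (cyc l w) = q" if "l \<le> w" "w < i" for w
    using that
  proof (induction w rule: dec_induct)
    case base
    show ?case by simp
  next
    case (step w)
    have "ract q (cyc l (Suc w)) = ract (ract q (cyc l w)) (adj w)"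
      using step by (simp add: cyc_Suc ract_comp bij_cyc bij_adj)
    also have "\<dots> = ract q (adj w)" using step by simp
    also have "\<dots> = q"
      using q step gap[of w] gap[of "Suc w"] i l by (auto simp: fixed_def)
    finally show ?case .
  qed
  have "R n (t n l) q = (\<Sum>w = l..n. ga_mult n q (ga_of (cyc l w)))"
    by (simp only: R_def t_def ga_mult_sum_right cyc_def)
  also have "\<dots> = (\<Sum>w = l..n. ract q (cyc l w))"
    using qga l by (intro sum.cong refl ga_mult_ga_of_right cyc_permutes) auto
  finally have shuffle: "R n (t n l) q = (\<Sum>w = l..n. ract q (cyc l w))" .
  have split: "(\<Sum>w = l..n. ract q (cyc l w))
      = (\<Sum>w = l..<i. ract q (cyc l w)) + (\<Sum>w = i..n. ract q (cyc l w))"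
    using i by (intro sum_atLeastAtMost_split) auto
  have scalar: "(\<Sum>w = l..<i. ract q (cyc l w)) = ga_scale (of_int (m_stat n I l)) q"
  proof -
    have "(\<Sum>w = l..<i. ract q (cyc l w)) = (\<Sum>w = l..<i. q)"
      by (rule sum.cong) (use head in auto)
    moreover have "(\<Sum>w\<in>A. q) = ga_scale (of_nat (card A)) q" for A :: "nat set"
      by (induction A rule: infinite_finite_induct)
        (auto simp: ga_scale_def fun_eq_iff algebra_simps)
    moreover have "(of_nat (card {l..<i}) :: 'a) = of_int (m_stat n I l)"
      using i by (simp add: m_stat_def i_def S_def)
    ultimately show ?thesis by (simp only:)
  qed
  have "R n (t n l) q - ga_scale (of_int (m_stat n I l)) q = (\<Sum>w = i..n. ract q (cyc l w))"
    unfolding shuffle split scalar by (rule add_diff_cancel_left')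
  also have "\<dots> \<in> lower n (wt I)"
  proof (cases "i = Suc n")
    case True
    then show ?thesis by (simp add: lower_def ga.span_zero)
  next
    case False
    then have iI: "i \<in> I" using i by simp
    define a where "a = max l (i - 1)"
    have a: "l \<le> a" "a \<le> i" using i(1) by (simp_all add: a_def)
    have "a = i \<or> Suc a = i" using i(1) l by (auto simp: a_def max_def)
    then have near: "a \<in> I \<or> Suc a \<in> I" using iI by metis
    have "ract q (cyc l a) = q"
    proof (cases "l < i")
      case True
      then have "a < i" by (simp add: a_def)
      with a(1) show ?thesis by (rule head)
    next
      case False
      then have "a = l" using i(1) by (simp add: a_def)
      then show ?thesis by simp
    qed
    then have "ract q (cyc l w) = ract q (cyc a w)" if "i \<le> w" for w
      by (simp only: cyc_trans[OF a(1) order.trans[OF a(2) that]] ract_comp bij_cyc)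
    then have "(\<Sum>w = i..n. ract q (cyc l w)) = (\<Sum>w = i..n. ract q (cyc a w))"
      by (intro sum.cong) auto
    also have "\<dots> \<in> lower n (wt I)"
      using q I _ a(2) near i(2)
      by (rule ract_tail_lower) (use a(1) l in simp)
    finally show ?thesis .
  qed
  finally show ?thesis .
qed

lemma R_combination_triangular:
  fixes lam :: "nat \<Rightarrow> 'k::field"
  assumes q: "q \<in> fixed n I" and I: "I \<subseteq> {1..n}"
  shows "R n (\<Sum>l = 1..n. ga_scale (lam l) (t n l)) q
    - ga_scale (\<Sum>l = 1..n. lam l * of_int (m_stat n I l)) q \<in> lower n (wt I)"
proof -
  have "R n (\<Sum>l = 1..n. ga_scale (lam l) (t n l)) q
      - ga_scale (\<Sum>l = 1..n. lam l * of_int (m_stat n I l)) q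
    = (\<Sum>l = 1..n. ga_scale (lam l) (R n (t n l) q - ga_scale (of_int (m_stat n I l)) q))"
    by (simp add: R_def ga_mult_sum_right ga_mult_scale_right ga.scale_sum_left
        ga.scale_right_diff_distrib sum_subtractf)
  also have "\<dots> \<in> lower n (wt I)"
    unfolding lower_def
    by (intro ga.span_sum ga.span_scale) (rule R_t_triangular[OF q I, unfolded lower_def])
  finally show ?thesis .
qed

lemma span_fixed_lacunar: "ga.span (\<Union>L\<in>lac n. fixed n L) = group_alg n"
proof
  show "ga.span (\<Union>L\<in>lac n. fixed n L) \<subseteq> group_alg n"
    by (intro ga.span_minimal subspace_group_alg) (auto simp: fixed_def)
  \<comment> \<open>With all of \<open>{1..n}\<close> as index set there are no conditions left.\<close>
  have "group_alg n = fixed n {1..n}"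
    by (auto simp: fixed_def)
  also have "\<dots> \<subseteq> (\<Union>L\<in>lac n. fixed n L)"
    using fixed_subset_lacunar[of "{1..n}" n] by blast
  finally show "group_alg n \<subseteq> ga.span (\<Union>L\<in>lac n. fixed n L)"
    using ga.span_superset by blast
qed

theorem theorem12p3:
  fixes n :: nat and lam :: "nat \<Rightarrow> 'k::field"
  assumes "inj_on (\<lambda>I. \<Sum>l = 1..n. lam l * of_int (m_stat n I l))
             {I. I \<subseteq> {1..n - 1} \<and> lacunar I}"
  shows "ga.diagonalizable_on (group_alg n) (R n (\<Sum>l = 1..n. ga_scale (lam l) (t n l)))"
proof (rule ga.diagonalizable_on_if_triangular)
  let ?T = "R n (\<Sum>l = 1..n. ga_scale (lam l) (t n l))"
  let ?ev = "\<lambda>I. \<Sum>l = 1..n. lam l * of_int (m_stat n I l)"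
  show "Vector_Spaces.linear ga_scale ga_scale ?T" by (rule linear_R)
  show "ga.span (\<Union>L\<in>lac n. fixed n L) = group_alg n" by (rule span_fixed_lacunar)
  show "inj_on ?ev (lac n)" by (rule assms)
  fix I and v :: "'k perm_fun"
  assume I: "I \<in> lac n" and v: "v \<in> fixed n I"
  have "{1..n - 1} \<subseteq> {1..n}" by auto
  with I have "I \<subseteq> {1..n}" by blast
  with v show "?T v - ga_scale (?ev I) v \<in> ga.span (\<Union>L\<in>{L \<in> lac n. wt L < wt I}. fixed n L)"
    by (rule R_combination_triangular[unfolded lower_def])
qed

end
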